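(* Let $a,b,c\in\mathbb{C}$ with $a+b+c=1$. Then for all complex $x,y,z$ with $|x|,|y|,|z|<1$, $$\prod_{\substack{l,m,n\ge 1,\ l\le n,\ m\le n\\ \gcd(l,m,n)=1}}\left(\frac{1}{1-x^ly^mz^n}\right)^{\frac{1}{l^a m^b n^c}}=\exp\left\{\sum_{n=1}^{\infty}\left(\sum_{l=1}^{n}\frac{x^l}{l^a}\right)\left(\sum_{m=1}^{n}\frac{y^m}{m^b}\right)\frac{z^n}{n^c}\right\},$$ where the product runs over all triples $(l,m,n)$ of positive integers with $l\le n$, $m\le n$ and $\gcd(l,m,n)=1$.
   Context: For a positive integer $j$ and complex $s$, $j^s=e^{s\ln j}$. For $|w|<1$ and complex $e$, $\left(\frac{1}{1-w}\right)^{e}$ means $\exp\left(-e\log(1-w)\right)$ with the principal branch of the logarithm. *)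

theory Defs
  imports "HOL-Analysis.Analysis"
begin

(* Unordered infinite product over an index set, the multiplicative analogue of the library's
   has_sum: the finite partial products converge along the directed set of finite subsets of A.
   The limit is required to be nonzero, as usual for infinite products without zero factors. *)
definition has_unordered_prod :: "('i \<Rightarrow> complex) \<Rightarrow> 'i set \<Rightarrow> complex \<Rightarrow> bool" where
  "has_unordered_prod f A P \<longleftrightarrow> ((\<lambda>F. \<Prod>i\<in>F. f i) \<longlongrightarrow> P) (finite_subsets_at_top A) \<and> P \<noteq> 0"

(* (1 / (1 - w)) to the power e, for norm w < 1; Ln is the principal branch. *)
definition geom_powr :: "complex \<Rightarrow> complex \<Rightarrow> complex" where
  "geom_powr w e = exp (- e * Ln (1 - w))"

definition coprime_triples :: "(nat \<times> nat \<times> nat) set" where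
  "coprime_triples =
     {(l, m, n). 1 \<le> l \<and> 1 \<le> m \<and> 1 \<le> n \<and> l \<le> n \<and> m \<le> n \<and> gcd l (gcd m n) = 1}"

lemma nat_powr_eq_exp_ln:
  fixes s :: complex
  assumes "j \<ge> 1"
  shows "of_nat j powr s = exp (s * of_real (ln (real j)))"
  using assms by (simp add: powr_def Ln_of_nat)

lemma geom_powr_eq_powr:
  assumes "norm w < 1"
  shows "geom_powr w e = (1 / (1 - w)) powr e"
proof -
  have "Re w < 1"
    using assms complex_Re_le_cmod[of w] by linarith
  then have "1 - w \<notin> \<real>\<^sub>\<le>\<^sub>0"
    by (auto simp: complex_nonpos_Reals_iff)
  moreover from this have "1 - w \<noteq> 0"
    by auto
  ultimately show ?thesis
    using Ln_inverse[of "1 - w"] by (simp add: geom_powr_def powr_def inverse_eq_divide)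
qed

end

theory Submission
  imports Defs "HOL-Real_Asymp.Real_Asymp"
begin

text \<open>
  Every triple of positive integers is uniquely \<open>(k l, k m, k n)\<close> with \<open>gcd(l, m, n) = 1\<close>. Taking
  logarithms, the factor of \<open>(l, m, n)\<close> contributes the Mercator series
  \<open>\<Sum>\<^sub>k w\<^sup>k / k\<close> with \<open>w = x\<^sup>l y\<^sup>m z\<^sup>n\<close>, and since \<open>k\<^sup>a k\<^sup>b k\<^sup>c = k\<close>, its \<open>k\<close>-th term is exactly the term
  of \<open>(k l, k m, k n)\<close> in the triple series on the right. Absolute convergence of that series
  justifies the rearrangement.
\<close>

text \<open>Since \<open>norm (of_nat n powr a)\<close> is \<open>real n powr Re a\<close>,
  consecutive coefficients have ratio tending to 1, so the radius of convergence is 1 for every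
  \<open>a\<close>. The term at index 0 is zero, because \<open>0 powr a = 0\<close> and division by
  zero yields 0.\<close>

lemma summable_norm_power_over_powr:
  fixes x a :: complex
  assumes "norm x < 1"
  shows "summable (\<lambda>n. norm (x ^ n / of_nat n powr a))"
proof -
  have "conv_radius (\<lambda>n. inverse (of_nat n powr a)) = ereal 1"
  proof (rule conv_radius_ratio_limit[OF refl])
    show "(\<lambda>n. norm (inverse (of_nat n powr a)) / norm (inverse (of_nat (Suc n) powr a)))
            \<longlonglongrightarrow> 1"
    proof (rule Lim_transform_eventually)
      show "(\<lambda>n. real (Suc n) powr Re a / real n powr Re a) \<longlonglongrightarrow> 1"
        by real_asymp
      show "\<forall>\<^sub>F n in sequentially. real (Suc n) powr Re a / real n powr Re a
              = norm (inverse (of_nat n powr a)) / norm (inverse (of_nat (Suc n) powr a))"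
        using eventually_gt_at_top[of 0]
      proof eventually_elim
        case (elim n)
        then show ?case
          using norm_powr_real_powr[of "of_nat n" a] norm_powr_real_powr[of "of_nat (Suc n)" a]
          by (simp add: norm_inverse norm_divide field_simps del: of_nat_Suc)
      qed
    qed
    show "\<forall>\<^sub>F n in sequentially. inverse (of_nat n powr a) \<noteq> 0"
      using eventually_gt_at_top[of 0] by eventually_elim (auto simp: powr_def)
  qed
  then have "summable (\<lambda>n. norm (inverse (of_nat n powr a) * x ^ n))"
    using assms by (intro abs_summable_in_conv_radius) simp
  then show ?thesis
    by (simp add: divide_inverse mult.commute)
qed

lemma summable_on_times_product:
  fixes f :: "'a \<Rightarrow> 'c :: {real_normed_field, banach}" and g :: "'b \<Rightarrow> 'c"
  assumes f: "(\<lambda>x. norm (f x)) summable_on A" and g: "(\<lambda>y. norm (g y)) summable_on B"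
  shows "(\<lambda>(x, y). norm (f x * g y)) summable_on A \<times> B"
proof (rule summable_on_SigmaI)
  fix x
  show "((\<lambda>y. case (x, y) of (x, y) \<Rightarrow> norm (f x * g y)) has_sum
          norm (f x) * (\<Sum>\<^sub>\<infinity>y\<in>B. norm (g y))) B"
    using has_sum_cmult_right[OF has_sum_infsum[OF g], of "norm (f x)"] by (simp add: norm_mult)
next
  show "(\<lambda>x. norm (f x) * (\<Sum>\<^sub>\<infinity>y\<in>B. norm (g y))) summable_on A"
    using f by (rule summable_on_cmult_left)
qed auto

lemma has_sum_mercator:
  fixes w :: complex
  assumes "norm w < 1"
  shows "((\<lambda>k. w ^ k / of_nat k) has_sum - Ln (1 - w)) {1..}"
proof -
  have sums: "(\<lambda>k. w ^ k / of_nat k) sums - Ln (1 - w)"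
    using sums_minus[OF Ln_series'[of "- w"]] assms by simp
  have "summable (\<lambda>k. norm (w ^ k / of_nat k powr 1))"
    using assms by (rule summable_norm_power_over_powr)
  then have "summable (\<lambda>k. norm (w ^ k / of_nat k))"
    by simp
  from norm_summable_imp_has_sum[OF this sums] show ?thesis
    \<comment> \<open>Index 0 may be dropped, since \<open>w ^ 0 / 0 = 0\<close>.\<close>
    by (rule has_sum_cong_neutral[THEN iffD1, rotated -1]) (auto simp: not_le)
qed

definition dominated_triples :: "(nat \<times> nat \<times> nat) set" where
  "dominated_triples = {(l, m, n). 1 \<le> l \<and> 1 \<le> m \<and> l \<le> n \<and> m \<le> n}"

text \<open>The inverse divides by the gcd \<open>d\<close>. Scaling a coprime triple by
  \<open>k\<close> makes its gcd \<open>k\<close>, so \<open>k\<close> is recovered, and a common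
  positive factor does not affect the inequalities \<open>l \<le> n\<close> and
  \<open>m \<le> n\<close>.\<close>

lemma bij_betw_scale_coprime_triples:
  "bij_betw (\<lambda>((l, m, n), k). (k * l, k * m, k * n))
     (coprime_triples \<times> {1..}) dominated_triples"
  (is "bij_betw ?f _ _")
proof -
  let ?g = "\<lambda>(l, m, n). let d = gcd l (gcd m n) in ((l div d, m div d, n div d), d)"
  have f: "?f \<in> coprime_triples \<times> {1..} \<rightarrow> dominated_triples"
    by (auto simp: coprime_triples_def dominated_triples_def)
  have "?g (l, m, n) \<in> coprime_triples \<times> {1..}"
    if t: "(l, m, n) \<in> dominated_triples" for l m n
  proof -
    define d where "d = gcd l (gcd m n)"
    have d: "d dvd l" "d dvd m" "d dvd n"
      by (auto simp: d_def intro: dvd_trans)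
    have pos: "l > 0" "m > 0" "n > 0" "l \<le> n" "m \<le> n"
      using t by (auto simp: dominated_triples_def)
    then have "d > 0"
      by (simp add: d_def)
    have "d * gcd (l div d) (gcd (m div d) (n div d)) = d * 1"
      using d by (simp add: gcd_mult_distrib_nat) (simp add: d_def)
    then have "gcd (l div d) (gcd (m div d) (n div d)) = 1"
      using \<open>d > 0\<close> by simp
    moreover have "l div d > 0" "m div d > 0" "n div d > 0"
      using d pos by (auto simp: div_greater_zero_iff intro: dvd_imp_le)
    moreover have "l div d \<le> n div d" "m div d \<le> n div d"
      using pos by (auto intro: div_le_mono)
    ultimately show ?thesis
      using \<open>d > 0\<close> by (auto simp: coprime_triples_def Let_def simp flip: d_def)
  qed
  then have g: "?g \<in> dominated_triples \<rightarrow> coprime_triples \<times> {1..}"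
    by auto
  have gf: "?g (?f p) = p" if "p \<in> coprime_triples \<times> {1..}" for p
    using that by (auto simp: coprime_triples_def simp flip: gcd_mult_distrib_nat)
  have fg: "?f (?g p) = p" for p
    by (auto simp: Let_def split: prod.splits intro!: dvd_mult_div_cancel intro: dvd_trans)
  show ?thesis
    using f g gf fg by (rule bij_betwI)
qed

text \<open>The exponential is continuous and turns finite sums into products; its limit is nonzero
  because it never vanishes.\<close>

lemma has_unordered_prod_exp:
  assumes "(f has_sum S) A"
  shows "has_unordered_prod (\<lambda>i. exp (f i)) A (exp S)"
proof -
  have "((\<lambda>F. exp (sum f F)) \<longlongrightarrow> exp S) (finite_subsets_at_top A)"
    using assms by (intro tendsto_exp) (simp add: has_sum_def)
  moreover have "\<forall>\<^sub>F F in finite_subsets_at_top A. exp (sum f F) = (\<Prod>i\<in>F. exp (f i))"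
    by (rule eventually_finite_subsets_at_top_weakI) (simp add: exp_sum)
  ultimately show ?thesis
    unfolding has_unordered_prod_def using tendsto_cong by fastforce
qed

text \<open>This turns the hypothesis on \<open>a + b + c\<close> into the denominator
  \<open>k\<close> of the Mercator series.\<close>

lemma of_nat_powr_sum_one:
  fixes a b c :: complex
  assumes "a + b + c = 1" and "k \<ge> 1"
  shows "of_nat k powr a * of_nat k powr b * of_nat k powr c = of_nat k"
  using assms by (simp flip: powr_add)

theorem theorem4p1:
  fixes a b c x y z :: complex
  assumes "a + b + c = 1"
    and "norm x < 1" and "norm y < 1" and "norm z < 1"
  defines "S \<equiv> (\<lambda>n::nat. (\<Sum>l=1..n. x ^ l / of_nat l powr a)
                          * (\<Sum>m=1..n. y ^ m / of_nat m powr b) * (z ^ n / of_nat n powr c))"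
  shows "summable (\<lambda>k. S (Suc k)) \<and>
         has_unordered_prod
           (\<lambda>(l, m, n). geom_powr (x ^ l * y ^ m * z ^ n)
                          (1 / (of_nat l powr a * of_nat m powr b * of_nat n powr c)))
           coprime_triples
           (exp (\<Sum>k. S (Suc k)))"
proof -
  define f where "f = (\<lambda>(l, m, n). (x ^ l / of_nat l powr a) *
    ((y ^ m / of_nat m powr b) * (z ^ n / of_nat n powr c)))"
  define T where "T = infsum f dominated_triples"
  have abs: "(\<lambda>n. norm (u ^ n / of_nat n powr e)) summable_on UNIV" if "norm u < 1" for u e :: complex
    using summable_norm_power_over_powr[OF that, of e]
    by (intro norm_summable_imp_summable_on) simp
  \<comment> \<open>\<open>f\<close> separates into three one-variable factors, so it is absolutely
    summable over all triples, hence over any subset.\<close>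
  have "(\<lambda>(m, n). norm ((y ^ m / of_nat m powr b) * (z ^ n / of_nat n powr c)))
          summable_on UNIV \<times> UNIV"
    using assms by (intro summable_on_times_product abs)
  then have "(\<lambda>p. norm (case p of (m, n) \<Rightarrow> (y ^ m / of_nat m powr b) * (z ^ n / of_nat n powr c)))
          summable_on UNIV"
    by (simp add: case_prod_unfold)
  from summable_on_times_product[OF abs[of x a] this]
  have "(\<lambda>p. norm (f p)) summable_on UNIV"
    using assms by (simp add: f_def case_prod_unfold)
  then have "f summable_on dominated_triples"
    using abs_summable_summable summable_on_subset_banach by blast
  then have T: "(f has_sum T) dominated_triples"
    unfolding T_def by (rule has_sum_infsum)

  \<comment> \<open>First evaluation of \<open>T\<close>: with \<open>n\<close> outermost, the inner
    sum runs over a finite square and factors into \<open>S n\<close>.\<close>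
  have "((\<lambda>p. f (case p of (n, l, m) \<Rightarrow> (l, m, n))) has_sum T)
          (SIGMA n:{1..}. {1..n} \<times> {1..n})"
    by (rule has_sum_reindex_bij_betw[THEN iffD2, OF _ T],
        rule bij_betwI[where g = "\<lambda>(l, m, n). (n, l, m)"])
       (auto simp: dominated_triples_def)
  then have "(S has_sum T) {1..}"
  proof (rule has_sum_SigmaD)
    fix n :: nat
    have "S n = (\<Sum>p\<in>{1..n} \<times> {1..n}. f (case (n, p) of (n, l, m) \<Rightarrow> (l, m, n)))"
      unfolding S_def sum_product unfolding sum_distrib_right sum.cartesian_product
      by (intro sum.cong) (auto simp: f_def mult.assoc)
    then show "((\<lambda>p. f (case (n, p) of (n, l, m) \<Rightarrow> (l, m, n))) has_sum S n) ({1..n} \<times> {1..n})"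
      by (intro has_sum_finiteI) auto
  qed
  moreover have "bij_betw Suc UNIV {1..}"
    by (rule bij_betwI[where g = "\<lambda>n. n - 1"]) auto
  ultimately have "((\<lambda>k. S (Suc k)) has_sum T) UNIV"
    by (simp add: has_sum_reindex_bij_betw)
  then have sums: "(\<lambda>k. S (Suc k)) sums T"
    by (rule has_sum_imp_sums)

  \<comment> \<open>\<open>G\<close> is the logarithm of a factor of the product:
    \<open>exp (G t)\<close> unfolds to the \<open>geom_powr\<close> factor at
    \<open>t\<close>.\<close>
  define G where "G = (\<lambda>(l, m, n). - (1 / (of_nat l powr a * of_nat m powr b * of_nat n powr c)) *
    Ln (1 - x ^ l * y ^ m * z ^ n))"
  \<comment> \<open>Second evaluation of \<open>T\<close>: sum along the multiples of each coprime
    triple first.\<close>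
  have "((\<lambda>p. f ((\<lambda>((l, m, n), k). (k * l, k * m, k * n)) p)) has_sum T)
          (coprime_triples \<times> {1..})"
    by (rule has_sum_reindex_bij_betw[THEN iffD2, OF bij_betw_scale_coprime_triples T])
  then have "(G has_sum T) coprime_triples"
  proof (rule has_sum_SigmaD)
    fix t assume "t \<in> coprime_triples"
    then obtain l m n where t: "t = (l, m, n)" "l \<ge> 1" "m \<ge> 1" "n \<ge> 1"
      by (auto simp: coprime_triples_def)
    define w where "w = x ^ l * y ^ m * z ^ n"
    define e where "e = 1 / (of_nat l powr a * of_nat m powr b * of_nat n powr c)"
    \<comment> \<open>The powers of \<open>x\<close> and \<open>y\<close> are bounded by 1;
      strictness comes from \<open>z\<close>, as \<open>n \<ge> 1\<close>.\<close>
    have "norm x ^ l * norm y ^ m * norm z ^ n \<le> 1 * 1 * norm z ^ n"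
      using assms by (intro mult_mono power_le_one) auto
    also have "\<dots> < 1"
      using assms t by (simp add: power_less_one_iff)
    finally have w: "norm w < 1"
      by (simp add: w_def norm_mult norm_power)
    have "((\<lambda>k. e * (w ^ k / of_nat k)) has_sum G t) {1..}"
      using has_sum_cmult_right[OF has_sum_mercator[OF w], of e]
      by (simp add: G_def t e_def w_def)
    moreover have "e * (w ^ k / of_nat k) = f (k * l, k * m, k * n)" if "k \<in> {1..}" for k
    proof -
      have k: "of_nat k = of_nat k powr a * of_nat k powr b * of_nat k powr c"
        using of_nat_powr_sum_one[OF assms(1), of k] that by simp
      \<comment> \<open>Both bases are nonnegative reals, so the principal branch is multiplicative
        here.\<close>
      have powr_k: "of_nat (k * j) powr s = of_nat k powr s * of_nat j powr s" for j and s :: complex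
        using powr_times_real[of "of_nat k" "of_nat j" s] by simp
      have power_k: "u ^ (k * j) = (u ^ j) ^ k" for u :: complex and j
        by (metis power_mult mult.commute)
      show ?thesis
        \<comment> \<open>Splitting the denominator \<open>k\<close> as in \<open>k\<close> lets
          each power of \<open>k\<close> merge with that of \<open>l\<close>, \<open>m\<close> or
          \<open>n\<close>.\<close>
        by (subst k)
           (simp add: f_def e_def w_def powr_k power_k power_mult_distrib mult_ac del: of_nat_mult)
    qed
    ultimately show "((\<lambda>k. f ((\<lambda>((l, m, n), k). (k * l, k * m, k * n)) (t, k)))
            has_sum G t) {1..}"
      by (subst has_sum_cong[where g = "\<lambda>k. e * (w ^ k / of_nat k)"]) (simp_all add: t)
  qed
  then have "has_unordered_prod (\<lambda>t. exp (G t)) coprime_triples (exp T)"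
    by (rule has_unordered_prod_exp)
  then show ?thesis
    using sums by (simp add: sums_iff G_def geom_powr_def case_prod_unfold)
qed

end
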